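(* Let $K$ be a field and let $A=K\langle x_1,\dots,x_d\rangle/I$ be a right prolongable monomial algebra. Then the following are equivalent: (1) $A$ is amenable as a right module over itself; (2) for every $D\in\mathbb N$ there exists a non-zero monomial $u\in A$ for which there is at most one length-$D$ monomial $v$ such that $uv\neq0$ in $A$; (3) with respect to any finite-dimensional generating subspace $V$ of $A$, $A$ has a Følner sequence as a right module over itself consisting of spaces spanned by monomials; (4) $A$ is exhaustively amenable as a right module over itself.
   Context: Algebras are associative and unital. A monomial algebra is an algebra $A=K\langle x_1,\dots,x_d\rangle/I$ where $I$ is an ideal generated by (non-empty) monomials $x_{i_1}\cdots x_{i_r}$; monomials of $A$ are the images of words in $x_1,\dots,x_d$ (including the empty word $1$). A non-zero monomial $u\in A$ is right prolongable if there is a non-empty monomial $v$ with $uv\neq0$; $A$ is right prolongable if all its non-zero monomials are right prolongable. For a right $A$-module $M$, a finite-dimensional subspace $V\leq A$ and $\varepsilon>0$, a finite-dimensional subspace $L\leq M$ is $(V,\varepsilon)$-invariant if $\dim_K LV<(1+\varepsilon)\dim_K L$, where $LV$ is the span of all products $\ell v$. $M$ is amenable if for every finite-dimensional $V\leq A$ and every $\varepsilon>0$ it has a $(V,\varepsilon)$-invariant subspace. $M$ is exhaustively amenable if for every finite-dimensional $V\leq A$, every $\varepsilon>0$ and every finite-dimensional $W\leq M$ there is a $(V,\varepsilon)$-invariant subspace of $M$ containing $W$. A generating subspace of $A$ is a subspace $V$ with $A=K\langle V\rangle$ (generated by $V$ as a unital algebra). A Følner sequence of $A$ as a right module over itself with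 respect to $V$ is a chain of finite-dimensional (non-zero) subspaces $L_1\subseteq L_2\subseteq\cdots$ of $A$ with $A=\bigcup_n L_n$ and $\dim_K L_nV/\dim_K L_n\to1$ as $n\to\infty$. *)

theory Defs
  imports Complex_Main "HOL-Library.Poly_Mapping"
begin

text \<open>
  Words form the free monoid under concatenation.  With this instance the convolution ring
  \<open>'x list \<Rightarrow>\<^sub>0 'k\<close> of finitely supported functions on words is the free algebra \<open>K\<langle>x\<^sub>1,\<dots>,x\<^sub>d\<rangle>\<close>,
  where the letters are the elements of the finite type \<open>'x\<close>, that is \<open>d = CARD('x)\<close>.
\<close>

instantiation list :: (type) monoid_add
begin

definition zero_list :: "'a list" where "0 = []"

definition plus_list :: "'a list \<Rightarrow> 'a list \<Rightarrow> 'a list" where "u + v = u @ v"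

instance by standard (simp_all add: zero_list_def plus_list_def)

end

type_synonym ('x, 'k) free_algebra = "'x list \<Rightarrow>\<^sub>0 'k"

definition word_monomial :: "'x list \<Rightarrow> ('x, 'k::field) free_algebra"
  where "word_monomial w = Poly_Mapping.single w 1"

definition two_sided_ideal :: "'a::ring_1 set \<Rightarrow> bool"
  where "two_sided_ideal J \<longleftrightarrow>
    0 \<in> J \<and> (\<forall>a\<in>J. \<forall>b\<in>J. a + b \<in> J) \<and> (\<forall>a\<in>J. \<forall>r. r * a \<in> J \<and> a * r \<in> J)"


locale k_algebra = vector_space scale
  for scale :: "'k::field \<Rightarrow> 'a::ring_1 \<Rightarrow> 'a" +
  assumes scale_mult_left: "scale c a * b = scale c (a * b)"
    and scale_mult_right: "a * scale c b = scale c (a * b)"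
begin

definition unital_subalgebra :: "'a set \<Rightarrow> bool"
  where "unital_subalgebra B \<longleftrightarrow> subspace B \<and> 1 \<in> B \<and> (\<forall>a\<in>B. \<forall>b\<in>B. a * b \<in> B)"

definition finite_dim_subspace :: "'a set \<Rightarrow> bool"
  where "finite_dim_subspace U \<longleftrightarrow> subspace U \<and> (\<exists>B. finite B \<and> span B = U)"

definition generating_subspace :: "'a set \<Rightarrow> bool"
  where "generating_subspace V \<longleftrightarrow> subspace V \<and> unital_subalgebra hull V = UNIV"

end


locale right_module = A: k_algebra scaleA + M: vector_space scaleM
  for scaleA :: "'k::field \<Rightarrow> 'a::ring_1 \<Rightarrow> 'a"
    and scaleM :: "'k \<Rightarrow> 'm::ab_group_add \<Rightarrow> 'm" +
  fixes act :: "'m \<Rightarrow> 'a \<Rightarrow> 'm"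
  assumes act_add_left: "act (m + n) a = act m a + act n a"
    and act_add_right: "act m (a + b) = act m a + act m b"
    and act_scale_left: "act (scaleM c m) a = scaleM c (act m a)"
    and act_scale_right: "act m (scaleA c a) = scaleM c (act m a)"
    and act_one: "act m 1 = m"
    and act_mult: "act m (a * b) = act (act m a) b"
begin

definition finite_dim_subspace :: "'m set \<Rightarrow> bool"
  where "finite_dim_subspace U \<longleftrightarrow> M.subspace U \<and> (\<exists>B. finite B \<and> M.span B = U)"

definition product_space :: "'m set \<Rightarrow> 'a set \<Rightarrow> 'm set"
  where "product_space L V = M.span {act l v | l v. l \<in> L \<and> v \<in> V}"

text \<open>The strict inequality excludes \<open>L = {0}\<close>.\<close>

definition invariant_subspace :: "'a set \<Rightarrow> real \<Rightarrow> 'm set \<Rightarrow> bool"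
  where "invariant_subspace V \<epsilon> L \<longleftrightarrow> finite_dim_subspace L \<and>
    real (M.dim (product_space L V)) < (1 + \<epsilon>) * real (M.dim L)"

definition amenable :: bool
  where "amenable \<longleftrightarrow> (\<forall>V \<epsilon>. A.finite_dim_subspace V \<longrightarrow> \<epsilon> > 0 \<longrightarrow>
    (\<exists>L. invariant_subspace V \<epsilon> L))"

definition exhaustively_amenable :: bool
  where "exhaustively_amenable \<longleftrightarrow> (\<forall>V \<epsilon> W. A.finite_dim_subspace V \<longrightarrow> \<epsilon> > 0 \<longrightarrow>
    finite_dim_subspace W \<longrightarrow> (\<exists>L. invariant_subspace V \<epsilon> L \<and> W \<subseteq> L))"

definition folner_sequence :: "'a set \<Rightarrow> (nat \<Rightarrow> 'm set) \<Rightarrow> bool"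
  where "folner_sequence V L \<longleftrightarrow>
    (\<forall>n. finite_dim_subspace (L n) \<and> L n \<noteq> {0} \<and> L n \<subseteq> L (Suc n)) \<and>
    (\<Union>n. L n) = UNIV \<and>
    (\<lambda>n. real (M.dim (product_space (L n) V)) / real (M.dim (L n))) \<longlonglongrightarrow> 1"

end

lemma (in k_algebra) right_regular_module: "right_module scale scale (*)"
  by unfold_locales (simp_all add: algebra_simps scale_mult_left scale_mult_right)


text \<open>
  The algebra \<open>A\<close> (the whole type \<open>'a\<close>) is presented as \<open>K\<langle>x\<^sub>1,\<dots>,x\<^sub>d\<rangle>/I\<close> by its quotient map \<open>\<phi>\<close>:
  a surjective algebra homomorphism whose kernel \<open>I\<close> is the ideal generated by the monomials
  in the (arbitrary, possibly infinite) set \<open>R\<close> of non-empty words.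
  Since \<open>1 \<notin> I\<close>, the requirement \<open>0 \<noteq> 1\<close> of class \<open>ring_1\<close> excludes nothing.
\<close>

locale monomial_algebra = k_algebra scale
  for scale :: "'k::field \<Rightarrow> 'a::ring_1 \<Rightarrow> 'a" +
  fixes \<phi> :: "('x::finite, 'k) free_algebra \<Rightarrow> 'a"
    and R :: "'x list set"
  assumes hom_add: "\<phi> (f + g) = \<phi> f + \<phi> g"
    and hom_mult: "\<phi> (f * g) = \<phi> f * \<phi> g"
    and hom_one: "\<phi> 1 = 1"
    and hom_scale: "\<phi> (Poly_Mapping.map ((*) c) f) = scale c (\<phi> f)"
    and hom_surj: "surj \<phi>"
    and relators_nonempty: "[] \<notin> R"
    and hom_kernel: "{f. \<phi> f = 0} = two_sided_ideal hull (word_monomial ` R)"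
begin

definition monomials :: "'a set"
  where "monomials = range (\<lambda>w. \<phi> (word_monomial w))"

definition nonempty_monomials :: "'a set"
  where "nonempty_monomials = (\<lambda>w. \<phi> (word_monomial w)) ` {w. w \<noteq> []}"

definition monomials_of_length :: "nat \<Rightarrow> 'a set"
  where "monomials_of_length D = (\<lambda>w. \<phi> (word_monomial w)) ` {w. length w = D}"

definition right_prolongable :: bool
  where "right_prolongable \<longleftrightarrow>
    (\<forall>u\<in>monomials. u \<noteq> 0 \<longrightarrow> (\<exists>v\<in>nonempty_monomials. u * v \<noteq> 0))"

definition monomial_subspace :: "'a set \<Rightarrow> bool"
  where "monomial_subspace U \<longleftrightarrow> (\<exists>T\<subseteq>monomials. U = span T)"

end

end

theory Submission
  imports Defs
begin

text \<open>
  Call a word non-zero if its image in \<open>A\<close> is non-zero.  As the relators are words, the images of the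
  non-zero words form a basis of \<open>A\<close>, with coordinate functionals \<open>coeff w\<close>, and the basis is closed
  under multiplication up to \<open>0\<close>.  Condition (2) says that for every \<open>D\<close> there is a \<open>rigid_word\<close>:
  a non-zero word whose non-zero extensions by \<open>D\<close> letters do not branch.

  (1) implies (2), lemma \<open>two_dim_le_dim_product_space\<close>.  If for some \<open>D\<close> every non-zero word has two
  non-zero extensions by \<open>D\<close> letters, let \<open>V\<close> be the span of the monomials of length \<open>D\<close>.  Put a basis
  \<open>l t\<close> (\<open>t \<in> T\<close>) of \<open>L\<close> into reduced echelon form, so that \<open>T\<close> is a set of words and \<open>l t\<close> has
  coefficient \<open>1\<close> at \<open>t\<close> and \<open>0\<close> at the other elements of \<open>T\<close>.  Since all the right factors have the same
  length, the coefficient of \<open>l t * v\<close> at \<open>t' @ v'\<close> is \<open>0\<close> unless \<open>t = t'\<close> and \<open>v = v'\<close>.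
  Hence the products with \<open>t @ v\<close> non-zero are independent, there are at least \<open>2 * dim L\<close> of them, and
  no \<open>L\<close> is \<open>(V, 1)\<close>-invariant.

  (2) implies (3), lemma \<open>invariant_span_of_words\<close>.  Let \<open>A\<^sub>n\<close> be the span of the words of length at most
  \<open>n\<close>.  By prolongability, the non-zero prolongations of a rigid word \<open>u\<close> by up to \<open>D\<close> letters are
  exactly the words \<open>u @ take i v\<close> for one word \<open>v\<close>.  The span of the first \<open>D - m + 1\<close> words of this path is
  multiplied by \<open>A\<^sub>m\<close> into the span of all the \<open>D + 1\<close> of them, so for large \<open>D\<close> the path is almost
  invariant.  It stays so after adding \<open>A\<^sub>n\<close>, which has fixed dimension, and these sums can be chosen as an
  increasing sequence that exhausts \<open>A\<close>.  A generating subspace \<open>V\<close> lies in some \<open>A\<^sub>m\<close>, which bounds the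
  growth ratio from above.  As \<open>V\<close> need not contain \<open>1\<close>, the lower bound \<open>1\<close> needs its own
  argument, \<open>card_le_dim_product_generating\<close>.

  (3) implies (4) because every finite-dimensional subspace of \<open>A\<close> lies in some \<open>A\<^sub>m\<close> with \<open>m > 0\<close>, which
  is generating, and in some term of a Folner sequence; (4) implies (1) by taking \<open>W = {0}\<close>.
\<close>

section \<open>Dimension bounds from linear functionals\<close>

text \<open>
  The matrix of the values \<open>f i (y j)\<close> is triangular with non-zero diagonal when the indices are sorted by
  \<open>h\<close>, hence the \<open>y j\<close> are independent.  All lower bounds on dimensions below come from this criterion.
\<close>
lemma (in vector_space) triangular_functionals_card_le_dim:
  fixes y :: "'i \<Rightarrow> 'b" and f :: "'i \<Rightarrow> 'b \<Rightarrow> 'a" and h :: "'i \<Rightarrow> nat"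
  assumes "finite I" and y: "y ` I \<subseteq> span B" and B: "finite B"
    and lin: "\<And>i. i \<in> I \<Longrightarrow> Vector_Spaces.linear scale (*) (f i)"
    and diag: "\<And>i. i \<in> I \<Longrightarrow> f i (y i) \<noteq> 0"
    and tri: "\<And>i j. i \<in> I \<Longrightarrow> j \<in> I \<Longrightarrow> i \<noteq> j \<Longrightarrow> h i \<le> h j \<Longrightarrow> f i (y j) = 0"
  shows "card I \<le> dim (span B)"
proof -
  have inj: "inj_on y I"
  proof (rule inj_onI, rule ccontr)
    fix i j assume ij: "i \<in> I" "j \<in> I" "y i = y j" "i \<noteq> j"
    show False
      using tri[of i j] tri[of j i] diag[of i] diag[of j] ij by (cases "h i \<le> h j") auto
  qed
  have "independent (y ` I)"
  proof (rule independent_if_scalars_zero)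
    fix c x assume eq: "(\<Sum>x\<in>y ` I. scale (c x) x) = 0" and x: "x \<in> y ` I"
    have sum0: "(\<Sum>j\<in>I. scale (c (y j)) (y j)) = 0"
      using eq by (simp add: sum.reindex[OF inj])
    have "\<forall>i\<in>I. c (y i) = 0"
    proof (rule ccontr)
      assume "\<not> ?thesis"
      then obtain i where "i \<in> I \<and> c (y i) \<noteq> 0" by blast
      (* Testing a relation with the functional of an h-minimal index in its support isolates
         the coefficient of that index. *)
      then obtain i where i: "i \<in> I" "c (y i) \<noteq> 0"
        and least: "\<And>j. j \<in> I \<Longrightarrow> c (y j) \<noteq> 0 \<Longrightarrow> h i \<le> h j"
        using ex_has_least_nat[of "\<lambda>i. i \<in> I \<and> c (y i) \<noteq> 0" i h] by blast
      interpret f: Vector_Spaces.linear scale "(*)" "f i" by (rule lin[OF i(1)])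
      have "0 = f i (\<Sum>j\<in>I. scale (c (y j)) (y j))"
        by (simp add: sum0 f.zero)
      also have "\<dots> = (\<Sum>j\<in>I. c (y j) * f i (y j))"
        by (simp add: f.sum f.scale)
      also have "\<dots> = (\<Sum>j\<in>I. if j = i then c (y i) * f i (y i) else 0)"
      proof (rule sum.cong[OF refl])
        fix j assume "j \<in> I"
        then show "c (y j) * f i (y j) = (if j = i then c (y i) * f i (y i) else 0)"
          using tri[of i j] least[of j] i(1) by (cases "c (y j) = 0") auto
      qed
      also have "\<dots> = c (y i) * f i (y i)"
        using i(1) \<open>finite I\<close> by simp
      finally show False
        using i diag by simp
    qed
    with x show "c x = 0" by blast
  qed (use \<open>finite I\<close> in simp)
  then have indep: "independent (y ` I)" .
  obtain C where C: "C \<subseteq> span B" "independent C" "span B \<subseteq> span C" "card C = dim (span B)"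
    by (rule basis_exists)
  have "finite C" using independent_span_bound[OF B C(2,1)] by simp
  then have "card (y ` I) \<le> card C"
    using independent_span_bound[OF _ indep subset_trans[OF y C(3)]] by simp
  then show ?thesis
    using C(4) by (simp add: card_image[OF inj])
qed

text \<open>
  Reduced echelon form without an order on the coordinates: a partial family is extended by a vector
  of \<open>L\<close> outside its span.  Subtracting its components along the family leaves a vector on which all the
  chosen functionals vanish, but not all functionals do; one that does not vanish becomes the new pivot,
  and the old vectors are cleared at it.
\<close>
lemma (in vector_space) biorthogonal_family:
  fixes c :: "'i \<Rightarrow> 'b \<Rightarrow> 'a"
  assumes lin: "\<And>i. Vector_Spaces.linear scale (*) (c i)"
    and sep: "\<And>a. a \<in> L \<Longrightarrow> a \<noteq> 0 \<Longrightarrow> \<exists>i. c i a \<noteq> 0"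
    and L: "subspace L"
  obtains T l where "finite T" and "card T = dim L" and "l ` T \<subseteq> L"
    and "\<forall>s\<in>T. \<forall>t\<in>T. c s (l t) = (if s = t then 1 else 0)"
proof -
  have "n \<le> dim L \<Longrightarrow> \<exists>T l. finite T \<and> card T = n \<and> l ` T \<subseteq> L \<and>
           (\<forall>s\<in>T. \<forall>t\<in>T. c s (l t) = (if s = t then 1 else 0))" for n
  proof (induction n)
    case 0
    show ?case by (rule exI[of _ "{}"]) simp
  next
    case (Suc n)
    then obtain T l where T: "finite T" "card T = n" and l: "l ` T \<subseteq> L"
      and bi: "\<And>s t. s \<in> T \<Longrightarrow> t \<in> T \<Longrightarrow> c s (l t) = (if s = t then 1 else 0)"
      by (auto dest: Suc_leD)
    have "\<not> L \<subseteq> span (l ` T)"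
      using dim_le_card[of L "l ` T"] card_image_le[OF T(1), of l] T Suc.prems by auto
    then obtain a where a: "a \<in> L" "a \<notin> span (l ` T)" by blast
    define a' where "a' = a - (\<Sum>t\<in>T. scale (c t a) (l t))"
    have "(\<Sum>t\<in>T. scale (c t a) (l t)) \<in> span (l ` T)"
      by (intro span_sum span_scale span_base imageI)
    then have "a' \<noteq> 0" using a(2) by (auto simp: a'_def)
    have a'L: "a' \<in> L"
      unfolding a'_def using l a(1)
      by (intro subspace_diff[OF L] subspace_sum[OF L] subspace_scale[OF L]) auto
    have a'T: "c s a' = 0" if "s \<in> T" for s
    proof -
      interpret f: Vector_Spaces.linear scale "(*)" "c s" by (rule lin)
      have "c s a' = c s a - (\<Sum>t\<in>T. c t a * c s (l t))"
        by (simp add: a'_def f.diff f.sum f.scale)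
      also have "(\<Sum>t\<in>T. c t a * c s (l t)) = (\<Sum>t\<in>T. if t = s then c t a else 0)"
        using bi that by (intro sum.cong) auto
      finally show ?thesis using that T(1) by simp
    qed
    obtain i where i: "c i a' \<noteq> 0" using sep[OF a'L \<open>a' \<noteq> 0\<close>] by blast
    then have "i \<notin> T" using a'T by blast
    define b where "b = scale (inverse (c i a')) a'"
    have bL: "b \<in> L" unfolding b_def by (intro subspace_scale[OF L] a'L)
    have cb: "c s b = inverse (c i a') * c s a'" for s
    proof -
      interpret f: Vector_Spaces.linear scale "(*)" "c s" by (rule lin)
      show ?thesis by (simp add: b_def f.scale)
    qed
    define l' where "l' t = (if t = i then b else l t - scale (c i (l t)) b)" for t
    have cl': "c s (l' t) = (if t = i then c s b else c s (l t) - c i (l t) * c s b)" for s t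
    proof -
      interpret f: Vector_Spaces.linear scale "(*)" "c s" by (rule lin)
      show ?thesis by (simp add: l'_def f.diff f.scale)
    qed
    have "l' ` insert i T \<subseteq> L"
      using l bL by (auto simp: l'_def intro!: subspace_diff[OF L] subspace_scale[OF L])
    moreover have "\<forall>s\<in>insert i T. \<forall>t\<in>insert i T. c s (l' t) = (if s = t then 1 else 0)"
      using \<open>i \<notin> T\<close> i by (auto simp: cl' cb a'T bi)
    ultimately show ?case
      using T \<open>i \<notin> T\<close> by (intro exI[of _ "insert i T"] exI[of _ l']) auto
  qed
  from this[OF order_refl] show ?thesis
    by (elim exE conjE) (rule that)
qed

section \<open>The monomial basis and its coordinates\<close>

text \<open>
  A word has only finitely many factorisations, one for each cut position.
\<close>
lemma lookup_mult_words:
  fixes f g :: "('x, 'k::field) free_algebra"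
  shows "Poly_Mapping.lookup (f * g) w = (\<Sum>i\<le>length w. Poly_Mapping.lookup f (take i w) * Poly_Mapping.lookup g (drop i w))"
proof -
  have inner: "(\<Sum>q. Poly_Mapping.lookup g q when w = u + q) =
      (if take (length u) w = u then Poly_Mapping.lookup g (drop (length u) w) else 0)" for u
  proof -
    have "(\<Sum>q. Poly_Mapping.lookup g q when w = u + q) =
        (\<Sum>q\<in>{drop (length u) w}. Poly_Mapping.lookup g q when w = u + q)"
      by (rule Sum_any.expand_superset) (auto simp: plus_list_def when_def)
    also have "\<dots> = (if take (length u) w = u then Poly_Mapping.lookup g (drop (length u) w) else 0)"
      using append_take_drop_id[of "length u" w] append_eq_conv_conj[of u "drop (length u) w" w]
      by (auto simp: plus_list_def when_def)
    finally show ?thesis .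
  qed
  have "Poly_Mapping.lookup (f * g) w = (\<Sum>u. Poly_Mapping.lookup f u *
      (if take (length u) w = u then Poly_Mapping.lookup g (drop (length u) w) else 0))"
    by (simp add: lookup_mult inner)
  also have "\<dots> = (\<Sum>u\<in>(\<lambda>i. take i w) ` {..length w}. Poly_Mapping.lookup f u *
      (if take (length u) w = u then Poly_Mapping.lookup g (drop (length u) w) else 0))"
  proof (rule Sum_any.expand_superset)
    have "u \<in> (\<lambda>i. take i w) ` {..length w}" if "take (length u) w = u" for u
    proof (rule image_eqI)
      show "u = take (length u) w" using that by simp
      show "length u \<in> {..length w}" using that by (metis atMost_iff length_take min.cobounded1)
    qed
    then show "{u. Poly_Mapping.lookup f u * (if take (length u) w = u then Poly_Mapping.lookup g (drop (length u) w) else 0) \<noteq> 0}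
      \<subseteq> (\<lambda>i. take i w) ` {..length w}" by auto
  qed simp
  also have "\<dots> = (\<Sum>i\<le>length w. Poly_Mapping.lookup f (take i w) * Poly_Mapping.lookup g (drop i w))"
  proof (subst sum.reindex)
    show "inj_on (\<lambda>i. take i w) {..length w}"
      by (rule inj_onI) (metis atMost_iff length_take min.absorb2)
  qed (auto intro!: sum.cong)
  finally show ?thesis .
qed

context monomial_algebra
begin

interpretation regular: right_module scale scale "(*)"
  by (rule right_regular_module)

abbreviation mon :: "'x list \<Rightarrow> 'a"
  where "mon w \<equiv> \<phi> (word_monomial w)"

lemma hom_zero: "\<phi> 0 = 0"
  using hom_add[of 0 0] by simp

lemma hom_diff: "\<phi> (f - g) = \<phi> f - \<phi> g"
  using hom_add[of "f - g" g] by simp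

lemma hom_sum: "\<phi> (sum f S) = (\<Sum>i\<in>S. \<phi> (f i))"
  by (induction S rule: infinite_finite_induct) (simp_all add: hom_zero hom_add)

lemma mon_Nil: "mon [] = 1"
  by (metis hom_one single_one word_monomial_def zero_list_def)

lemma mon_append: "mon (u @ v) = mon u * mon v"
  by (simp add: word_monomial_def mult_single plus_list_def flip: hom_mult)

lemma mon_append_nonzeroD: "mon (u @ v) \<noteq> 0 \<Longrightarrow> mon u \<noteq> 0 \<and> mon v \<noteq> 0"
  by (auto simp: mon_append)

text \<open>
  Combinations of words that vanish in \<open>A\<close> form a two-sided ideal containing the relators.  The kernel is
  the least such ideal, so it has no element that involves a non-zero word.  This is where the relators being
  monomials is used.
\<close>
lemma kernel_keys:
  assumes "\<phi> f = 0" and "w \<in> Poly_Mapping.keys f"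
  shows "mon w = 0"
proof -
  define J where "J = {f :: ('x, 'k) free_algebra. \<forall>w\<in>Poly_Mapping.keys f. mon w = 0}"
  have "two_sided_ideal J"
    unfolding two_sided_ideal_def
  proof (intro conjI ballI allI)
    show "0 \<in> J" by (simp add: J_def)
  next
    fix a b assume "a \<in> J" "b \<in> J"
    then show "a + b \<in> J" using keys_add[of a b] by (auto simp: J_def)
  next
    fix a r assume a: "a \<in> J"
    show "r * a \<in> J"
      using a keys_mult[of r a] by (fastforce simp: J_def plus_list_def mon_append)
    show "a * r \<in> J"
      using a keys_mult[of a r] by (fastforce simp: J_def plus_list_def mon_append)
  qed
  moreover have "word_monomial ` R \<subseteq> J"
  proof
    fix f :: "('x, 'k) free_algebra" assume "f \<in> word_monomial ` R"
    then obtain r where r: "f = word_monomial r" "r \<in> R" by blast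
    then have "f \<in> two_sided_ideal hull (word_monomial ` R)" by (simp add: hull_inc)
    then have "mon r = 0" using hom_kernel r(1) by blast
    then show "f \<in> J" by (simp add: r(1) J_def word_monomial_def)
  qed
  ultimately have "two_sided_ideal hull (word_monomial ` R) \<subseteq> J"
    by (intro hull_minimal)
  then show ?thesis using assms hom_kernel by (auto simp: J_def)
qed

text \<open>
  The preimage in the free algebra is unique up to words that vanish in \<open>A\<close>, so its coefficient is
  well defined at the other words; for a vanishing word the value is set to \<open>0\<close>.
\<close>
definition coeff :: "'x list \<Rightarrow> 'a \<Rightarrow> 'k"
  where "coeff w a = (if mon w = 0 then 0 else Poly_Mapping.lookup (inv \<phi> a) w)"

lemma coeff_hom: "mon w \<noteq> 0 \<Longrightarrow> coeff w (\<phi> f) = Poly_Mapping.lookup f w"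
proof -
  assume w: "mon w \<noteq> 0"
  have "\<phi> (inv \<phi> (\<phi> f) - f) = 0"
    by (simp add: hom_diff surj_f_inv_f[OF hom_surj])
  then have "w \<notin> Poly_Mapping.keys (inv \<phi> (\<phi> f) - f)" using kernel_keys w by blast
  then show ?thesis using w by (simp add: coeff_def in_keys_iff lookup_minus)
qed

lemma coeff_zero_monomial: "mon w = 0 \<Longrightarrow> coeff w a = 0"
  by (simp add: coeff_def)

lemma linear_coeff: "Vector_Spaces.linear scale (*) (coeff w)"
proof -
  have add: "coeff w (a + b) = coeff w a + coeff w b" for a b
  proof (cases "mon w = 0")
    case False
    obtain f g where "a = \<phi> f" "b = \<phi> g" using hom_surj by (metis surjD)
    then show ?thesis using False by (simp add: coeff_hom lookup_add flip: hom_add)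
  qed (simp add: coeff_zero_monomial)
  have scale: "coeff w (scale c a) = c * coeff w a" for c a
  proof (cases "mon w = 0")
    case False
    obtain f where "a = \<phi> f" using hom_surj by (metis surjD)
    then show ?thesis
      using False by (simp add: coeff_hom Poly_Mapping.map.rep_eq when_def flip: hom_scale)
  qed (simp add: coeff_zero_monomial)
  show ?thesis
    by unfold_locales (simp_all add: add scale algebra_simps)
qed

interpretation coeff: Vector_Spaces.linear scale "(*)" "coeff w" for w
  by (rule linear_coeff)

lemma coeff_mon: "mon w \<noteq> 0 \<Longrightarrow> coeff w (mon v) = (if w = v then 1 else 0)"
  by (simp add: coeff_hom word_monomial_def lookup_single when_def)

lemma coeff_expansion:
  obtains F where "finite F" and "a = (\<Sum>w\<in>F. scale (coeff w a) (mon w))"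
proof -
  obtain f where f: "a = \<phi> f" using hom_surj by (metis surjD)
  have eq: "f = (\<Sum>w\<in>Poly_Mapping.keys f. Poly_Mapping.map ((*) (Poly_Mapping.lookup f w)) (word_monomial w))"
    by (rule poly_mapping_eqI)
      (simp add: lookup_sum Poly_Mapping.map.rep_eq word_monomial_def lookup_single when_def
        in_keys_iff if_distrib cong: if_cong)
  have "\<phi> f = (\<Sum>w\<in>Poly_Mapping.keys f. scale (Poly_Mapping.lookup f w) (mon w))"
    by (subst eq) (simp add: hom_sum hom_scale)
  also have "\<dots> = (\<Sum>w\<in>Poly_Mapping.keys f. scale (coeff w a) (mon w))"
  proof (rule sum.cong[OF refl])
    fix w
    show "scale (Poly_Mapping.lookup f w) (mon w) = scale (coeff w a) (mon w)"
      by (cases "mon w = 0") (simp_all add: f coeff_hom)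
  qed
  finally have "a = (\<Sum>w\<in>Poly_Mapping.keys f. scale (coeff w a) (mon w))" using f by simp
  then show ?thesis using that[of "Poly_Mapping.keys f"] by simp
qed

lemma coeff_separating: "a \<noteq> 0 \<Longrightarrow> \<exists>w. coeff w a \<noteq> 0"
proof (rule ccontr)
  assume "a \<noteq> 0" and zero: "\<not> (\<exists>w. coeff w a \<noteq> 0)"
  obtain F where "a = (\<Sum>w\<in>F. scale (coeff w a) (mon w))" by (rule coeff_expansion)
  also have "\<dots> = 0" using zero by simp
  finally show False using \<open>a \<noteq> 0\<close> by simp
qed

lemma coeff_mult:
  assumes w: "mon w \<noteq> 0"
  shows "coeff w (a * b) = (\<Sum>i\<le>length w. coeff (take i w) a * coeff (drop i w) b)"
proof -
  obtain f g where fg: "a = \<phi> f" "b = \<phi> g" using hom_surj by (metis surjD)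
  have "mon (take i w) \<noteq> 0 \<and> mon (drop i w) \<noteq> 0" for i
    using w by (intro mon_append_nonzeroD) simp
  then show ?thesis
    using w by (simp add: fg coeff_hom lookup_mult_words flip: hom_mult)
qed

lemma coeff_mon_mult:
  assumes w: "mon w \<noteq> 0"
  shows "coeff w (mon u * b) = (if take (length u) w = u then coeff (drop (length u) w) b else 0)"
proof -
  have nz: "mon (take i w) \<noteq> 0" for i
    using w mon_append_nonzeroD[of "take i w" "drop i w"] by simp
  have "coeff w (mon u * b) =
      (\<Sum>i\<le>length w. if i = length u \<and> take (length u) w = u then coeff (drop i w) b else 0)"
    unfolding coeff_mult[OF w]
  proof (rule sum.cong[OF refl])
    fix i assume "i \<in> {..length w}"
    then have "take i w = u \<longleftrightarrow> i = length u \<and> take (length u) w = u" by auto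
    then show "coeff (take i w) (mon u) * coeff (drop i w) b =
        (if i = length u \<and> take (length u) w = u then coeff (drop i w) b else 0)"
      by (auto simp: coeff_mon[OF nz])
  qed
  also have "\<dots> = (if take (length u) w = u then coeff (drop (length u) w) b else 0)"
  proof (cases "take (length u) w = u")
    case True
    then have "length u \<le> length w" by (metis length_take min.cobounded1)
    with True show ?thesis by simp
  qed simp
  finally show ?thesis .
qed

text \<open>
  Right factors of equal length can be read off as suffixes, so products with distinct
  right factors have disjoint supports.
\<close>
lemma coeff_mult_mon:
  assumes nz: "mon (u @ v) \<noteq> 0" and len: "length v' = length v"
  shows "coeff (u @ v) (a * mon v') = (if v = v' then coeff u a else 0)"
proof -
  have nz': "mon (drop i (u @ v)) \<noteq> 0" for i
    using nz mon_append_nonzeroD[of "take i (u @ v)" "drop i (u @ v)"]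
    unfolding append_take_drop_id by blast
  have "coeff (u @ v) (a * mon v') =
      (\<Sum>i\<le>length (u @ v). if i = length u then (if v = v' then coeff u a else 0) else 0)"
    unfolding coeff_mult[OF nz]
  proof (rule sum.cong[OF refl])
    fix i assume "i \<in> {..length (u @ v)}"
    then have "drop i (u @ v) = v' \<longleftrightarrow> i = length u \<and> v = v'"
      using len by (auto dest!: arg_cong[of _ _ length])
    then have "coeff (drop i (u @ v)) (mon v') = (if i = length u \<and> v = v' then 1 else 0)"
      by (simp only: coeff_mon[OF nz'])
    then show "coeff (take i (u @ v)) a * coeff (drop i (u @ v)) (mon v') =
        (if i = length u then (if v = v' then coeff u a else 0) else 0)"
      by simp
  qed
  then show ?thesis by simp
qed

section \<open>Finite-dimensional subspaces and their products\<close>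

lemma dim_span_mon:
  assumes fin: "finite T" and nz: "\<And>w. w \<in> T \<Longrightarrow> mon w \<noteq> 0"
  shows "dim (span (mon ` T)) = card T"
proof (rule antisym)
  show "dim (span (mon ` T)) \<le> card T"
    using dim_le_card[of "span (mon ` T)" "mon ` T"] card_image_le[OF fin, of mon] fin by simp
  show "card T \<le> dim (span (mon ` T))"
    by (rule triangular_functionals_card_le_dim[where y = mon and f = coeff and h = "\<lambda>_. 0"])
      (use fin nz in \<open>auto simp: coeff_mon span_superset linear_coeff\<close>)
qed

lemma product_space_span_subset:
  assumes "\<And>s t. s \<in> S \<Longrightarrow> t \<in> T \<Longrightarrow> s * t \<in> span Z"
  shows "regular.product_space (span S) (span T) \<subseteq> span Z"
proof -
  have 1: "s * b \<in> span Z" if "s \<in> S" "b \<in> span T" for s b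
    using that(2)
    by (induction rule: span_induct_alt)
      (auto simp: distrib_left scale_mult_right span_zero intro!: span_add span_scale assms that(1))
  have "a * b \<in> span Z" if "a \<in> span S" "b \<in> span T" for a b
    using that(1)
    by (induction rule: span_induct_alt)
      (auto simp: distrib_right scale_mult_left span_zero intro!: span_add span_scale 1 that(2))
  then show ?thesis
    unfolding regular.product_space_def by (intro span_minimal subspace_span) auto
qed

definition filtration :: "nat \<Rightarrow> 'a set"
  where "filtration n = span (mon ` {w. length w \<le> n})"

lemma finite_words: "finite {w :: 'x list. length w \<le> n}"
  using finite_lists_length_le[of "UNIV :: 'x set" n] by simp

lemma filtration_mono: "m \<le> n \<Longrightarrow> filtration m \<subseteq> filtration n"
  unfolding filtration_def by (intro span_mono image_mono) auto

lemma in_filtration: "\<exists>n. a \<in> filtration n"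
proof -
  obtain F where F: "finite F" "a = (\<Sum>w\<in>F. scale (coeff w a) (mon w))"
    by (rule coeff_expansion)
  obtain n where n: "\<forall>w\<in>F. length w \<le> n"
    using F(1) finite_nat_set_iff_bounded_le[of "length ` F"] by auto
  have "(\<Sum>w\<in>F. scale (coeff w a) (mon w)) \<in> filtration n"
    unfolding filtration_def using n by (intro span_sum span_scale span_base imageI) auto
  then show ?thesis using F(2) by auto
qed

lemma finite_dim_subset_filtration:
  assumes "finite_dim_subspace U"
  shows "\<exists>n. U \<subseteq> filtration n"
proof -
  obtain B where B: "finite B" "span B = U" using assms by (auto simp: finite_dim_subspace_def)
  obtain k where k: "\<And>b. b \<in> filtration (k b)" using in_filtration by metis
  obtain n where n: "\<forall>b\<in>B. k b \<le> n"
    using B(1) finite_nat_set_iff_bounded_le[of "k ` B"] by auto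
  have "B \<subseteq> filtration n"
    using k filtration_mono[of "k _" n] n by (auto intro: subsetD)
  then have "span B \<subseteq> filtration n"
    unfolding filtration_def by (intro span_minimal subspace_span)
  then show ?thesis using B by auto
qed

section \<open>Words whose prolongations do not branch\<close>

lemma inj_on_mon: "inj_on mon {w. mon w \<noteq> 0}"
proof (rule inj_onI)
  fix u v assume "u \<in> {w. mon w \<noteq> 0}" "mon u = mon v"
  then show "u = v" using coeff_mon[of u u] coeff_mon[of u v] by (simp split: if_splits)
qed

text \<open>
  In a right prolongable algebra such a prolongation by \<open>D\<close> letters also exists, and uniqueness passes to
  all shorter prolongations: up to \<open>D\<close> letters, the prolongations of \<open>u\<close> form a path.
\<close>
definition rigid_word :: "nat \<Rightarrow> 'x list \<Rightarrow> bool"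
  where "rigid_word D u \<longleftrightarrow> mon u \<noteq> 0 \<and>
    (\<forall>v v'. length v = D \<longrightarrow> length v' = D \<longrightarrow> mon (u @ v) \<noteq> 0 \<longrightarrow> mon (u @ v') \<noteq> 0 \<longrightarrow> v = v')"

lemma rigid_word_iff_Uniq:
  "rigid_word D u \<longleftrightarrow>
    mon u \<noteq> 0 \<and> (\<exists>\<^sub>\<le>\<^sub>1 v. v \<in> monomials_of_length D \<and> mon u * v \<noteq> 0)"
proof -
  have "mon v = mon v' \<longleftrightarrow> v = v'" if "mon (u @ v) \<noteq> 0" "mon (u @ v') \<noteq> 0" for v v'
    using inj_onD[OF inj_on_mon, of v v'] mon_append_nonzeroD[OF that(1)]
      mon_append_nonzeroD[OF that(2)] by auto
  moreover have "(\<exists>\<^sub>\<le>\<^sub>1 v. v \<in> monomials_of_length D \<and> mon u * v \<noteq> 0) \<longleftrightarrow>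
      (\<forall>v v'. length v = D \<longrightarrow> length v' = D \<longrightarrow> mon (u @ v) \<noteq> 0 \<longrightarrow> mon (u @ v') \<noteq> 0 \<longrightarrow>
        mon v = mon v')"
    unfolding Uniq_def monomials_of_length_def mon_append by blast
  ultimately show ?thesis
    unfolding rigid_word_def by blast
qed

lemma rigid_monomial_iff_rigid_word:
  "(\<exists>u\<in>monomials. u \<noteq> 0 \<and> (\<exists>\<^sub>\<le>\<^sub>1 v. v \<in> monomials_of_length D \<and> u * v \<noteq> 0)) \<longleftrightarrow>
    (\<exists>u. rigid_word D u)"
  by (auto simp: rigid_word_iff_Uniq monomials_def)

lemma product_space_mono:
  "L \<subseteq> L' \<Longrightarrow> V \<subseteq> V' \<Longrightarrow> regular.product_space L V \<subseteq> regular.product_space L' V'"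
  unfolding regular.product_space_def by (intro span_mono) blast

lemma product_in_product_space: "l \<in> L \<Longrightarrow> v \<in> V \<Longrightarrow> l * v \<in> regular.product_space L V"
  unfolding regular.product_space_def by (intro span_base) blast

lemma finite_dim_product_space:
  assumes "finite_dim_subspace L" and "finite_dim_subspace V"
  shows "finite_dim_subspace (regular.product_space L V)"
proof -
  obtain B where B: "finite B" "span B = L"
    using assms(1) by (auto simp: finite_dim_subspace_def)
  obtain C where C: "finite C" "span C = V"
    using assms(2) by (auto simp: finite_dim_subspace_def)
  let ?Z = "(\<lambda>(b, c). b * c) ` (B \<times> C)"
  have "regular.product_space L V \<subseteq> span ?Z"
    unfolding B(2)[symmetric] C(2)[symmetric]
    by (rule product_space_span_subset) (auto intro!: span_base)
  moreover have "span ?Z \<subseteq> regular.product_space L V"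
    unfolding regular.product_space_def
    using span_superset[of B] span_superset[of C] B(2) C(2)
    by (intro span_mono) auto
  ultimately show ?thesis
    unfolding finite_dim_subspace_def using B(1) C(1)
    by (metis finite_SigmaI finite_imageI subset_antisym subspace_span)
qed

lemma finite_dim_span: "finite B \<Longrightarrow> finite_dim_subspace (span B)"
  by (auto simp: finite_dim_subspace_def)

lemma finite_dim_filtration: "finite_dim_subspace (filtration n)"
  unfolding filtration_def by (intro finite_dim_span finite_imageI finite_words)

lemma finite_dim_span_monomials_of_length: "finite_dim_subspace (span (monomials_of_length D))"
  unfolding monomials_of_length_def
  by (rule finite_dim_span, rule finite_imageI, rule finite_subset[OF _ finite_words[of D]]) auto

lemma dim_mono_finite_dim:
  assumes "U \<subseteq> W" and "finite_dim_subspace W"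
  shows "dim U \<le> dim W"
proof -
  obtain B where B: "finite B" "span B = W"
    using assms(2) by (auto simp: finite_dim_subspace_def)
  obtain C where C: "C \<subseteq> W" "independent C" "W \<subseteq> span C" "card C = dim W"
    by (rule basis_exists)
  have "finite C" using independent_span_bound[OF B(1) C(2)] C(1) B(2) by simp
  then show ?thesis
    using dim_le_card[of U C] assms(1) C(3,4) by simp
qed

section \<open>Branching of all words excludes invariant subspaces\<close>

text \<open>
  If no word is rigid, each pivot \<open>t\<close> of an echelon basis \<open>l\<close> of \<open>L\<close> has two prolongations \<open>t @ v\<close>, and the
  functionals \<open>coeff (t @ v)\<close> are biorthogonal to the products \<open>l t * mon v\<close>.
\<close>
lemma two_dim_le_dim_product_space:
  assumes L: "finite_dim_subspace L"
    and branch: "\<nexists>u. rigid_word D u"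
  shows "2 * dim L \<le> dim (regular.product_space L (span (monomials_of_length D)))"
proof -
  let ?V = "span (monomials_of_length D)"
  have subspace_L: "subspace L" using L by (auto simp: finite_dim_subspace_def)
  obtain T l where T: "finite T" "card T = dim L" and l: "l ` T \<subseteq> L"
    and bi: "\<forall>s\<in>T. \<forall>t\<in>T. coeff s (l t) = (if s = t then 1 else 0)"
    by (rule biorthogonal_family[OF linear_coeff coeff_separating subspace_L])
  have nz: "mon t \<noteq> 0" if "t \<in> T" for t
    using bi that coeff_zero_monomial[of t "l t"] by fastforce
  define P where "P t = {v. length v = D \<and> mon (t @ v) \<noteq> 0}" for t
  have fin: "finite (P t)" for t
    unfolding P_def by (rule finite_subset[OF _ finite_words[of D]]) auto
  have two: "2 \<le> card (P t)" if t: "t \<in> T" for t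
  proof -
    have "\<not> rigid_word D t" using branch by blast
    then obtain v v' where "{v, v'} \<subseteq> P t" "v \<noteq> v'"
      using nz[OF t] by (auto simp: rigid_word_def P_def)
    then show ?thesis using card_mono[OF fin, of "{v, v'}" t] by simp
  qed
  have "finite_dim_subspace (regular.product_space L ?V)"
    by (rule finite_dim_product_space[OF L finite_dim_span_monomials_of_length])
  then obtain B where B: "finite B" "span B = regular.product_space L ?V"
    by (auto simp: finite_dim_subspace_def)
  have "card (Sigma T P) \<le> dim (span B)"
  proof (rule triangular_functionals_card_le_dim[where y = "\<lambda>(t, v). l t * mon v"
        and f = "\<lambda>(t, v). coeff (t @ v)" and h = "\<lambda>_. 0"])
    show "finite (Sigma T P)" using T(1) fin by simp
    show "(\<lambda>(t, v). l t * mon v) ` Sigma T P \<subseteq> span B"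
      unfolding B(2) using l
      by (auto intro!: product_in_product_space span_base simp: P_def monomials_of_length_def)
    show "Vector_Spaces.linear scale (*) ((\<lambda>(t, v). coeff (t @ v)) i)" for i
      by (cases i) (simp add: linear_coeff)
  next
    fix i assume "i \<in> Sigma T P"
    then show "(\<lambda>(t, v). coeff (t @ v)) i ((\<lambda>(t, v). l t * mon v) i) \<noteq> 0"
      by (auto simp: P_def coeff_mult_mon bi)
  next
    fix i j assume "i \<in> Sigma T P" "j \<in> Sigma T P" "i \<noteq> j"
    then show "(\<lambda>(t, v). coeff (t @ v)) i ((\<lambda>(t, v). l t * mon v) j) = 0"
      by (auto simp: P_def coeff_mult_mon bi split: if_splits)
  qed (use B(1) in simp)
  moreover have "2 * card T \<le> card (Sigma T P)"
    using sum_mono[of T "\<lambda>_. 2" "\<lambda>t. card (P t)"] two T(1) fin by (simp add: card_SigmaI)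
  ultimately show ?thesis using T(2) B(2) by simp
qed

lemma amenable_imp_rigid_word:
  assumes "regular.amenable"
  shows "\<exists>u. rigid_word D u"
proof (rule ccontr)
  assume branch: "\<not> ?thesis"
  let ?V = "span (monomials_of_length D)"
  obtain L where "regular.invariant_subspace ?V 1 L"
    using assms finite_dim_span_monomials_of_length zero_less_one unfolding regular.amenable_def by blast
  then show False
    using two_dim_le_dim_product_space[OF _ branch, of L]
    by (simp add: regular.invariant_subspace_def regular.finite_dim_subspace_def finite_dim_subspace_def)
qed

section \<open>Almost invariant spans of monomials\<close>

lemma prolong_word:
  assumes "right_prolongable" and "mon u \<noteq> 0"
  shows "\<exists>v. length v = k \<and> mon (u @ v) \<noteq> 0"
proof (induction k)
  case 0
  show ?case using assms(2) by simp
next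
  case (Suc k)
  then obtain v where v: "length v = k" "mon (u @ v) \<noteq> 0" by blast
  then obtain w where w: "w \<noteq> []" "mon (u @ v) * mon w \<noteq> 0"
    using assms(1) by (auto simp: right_prolongable_def monomials_def nonempty_monomials_def)
  then obtain x w' where "w = x # w'" by (cases w) auto
  then have "mon ((u @ v @ [x]) @ w') \<noteq> 0" using w(2) by (simp flip: mon_append)
  then have "mon (u @ v @ [x]) \<noteq> 0" using mon_append_nonzeroD by blast
  then show ?case using v(1) by (intro exI[of _ "v @ [x]"]) simp
qed

text \<open>
  Two different prolongations of equal length at most \<open>D\<close> could be continued to two different
  prolongations of length \<open>D\<close>.
\<close>
lemma rigid_word_unique_prolongation:
  assumes "right_prolongable" and "rigid_word D u"
  shows "\<exists>v. length v = D \<and> mon (u @ v) \<noteq> 0 \<and>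
    (\<forall>z. length z \<le> D \<longrightarrow> mon (u @ z) \<noteq> 0 \<longrightarrow> z = take (length z) v)"
proof -
  have "mon u \<noteq> 0" using assms(2) by (simp add: rigid_word_def)
  then obtain v where v: "length v = D" "mon (u @ v) \<noteq> 0"
    using prolong_word[OF assms(1)] by blast
  have "z = take (length z) v" if z: "length z \<le> D" "mon (u @ z) \<noteq> 0" for z
  proof -
    obtain y where "length y = D - length z" "mon ((u @ z) @ y) \<noteq> 0"
      using prolong_word[OF assms(1) z(2)] by blast
    then have "z @ y = v"
      using assms(2) v z(1) by (simp add: rigid_word_def)
    then show ?thesis by auto
  qed
  with v show ?thesis by blast
qed

text \<open>
  The witness consists of all non-zero words of length at most \<open>n\<close> and of a path of \<open>k + 1\<close> words that
  start with a rigid word.  Multiplication by \<open>filtration m\<close> lengthens the path by only \<open>m\<close> words and sends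
  the short words into a space whose dimension does not depend on \<open>k\<close>.
\<close>
lemma invariant_span_of_words:
  fixes \<epsilon> :: real
  assumes rp: "right_prolongable" and rigid: "\<And>D. \<exists>u. rigid_word D u" and "\<epsilon> > 0"
  shows "\<exists>T. finite T \<and> (\<forall>w\<in>T. mon w \<noteq> 0) \<and> {w. length w \<le> n \<and> mon w \<noteq> 0} \<subseteq> T \<and>
    real (dim (regular.product_space (span (mon ` T)) (filtration m))) < (1 + \<epsilon>) * real (card T)"
proof -
  define C where "C = card {w :: 'x list. length w \<le> n + m}"
  (* The product has dimension at most C + (k + m + 1), against a path of length k + 1, so C + m + 1
     has to be less than eps * k. *)
  obtain k :: nat where k: "real (C + m + 1) / \<epsilon> < real k"
    using reals_Archimedean2 by blast
  define D where "D = k + m"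
  obtain u where u: "rigid_word D u" using rigid by blast
  obtain v where v: "length v = D" "mon (u @ v) \<noteq> 0"
    and uniq: "\<And>z. length z \<le> D \<Longrightarrow> mon (u @ z) \<noteq> 0 \<Longrightarrow> z = take (length z) v"
    using rigid_word_unique_prolongation[OF rp u] by blast
  define S where "S j = (\<lambda>i. u @ take i v) ` {..j}" for j
  define T where "T = {w. length w \<le> n \<and> mon w \<noteq> 0} \<union> S k"
  have nzS: "mon w \<noteq> 0" if w: "w \<in> S j" for w j
  proof -
    obtain i where "w = u @ take i v" using w by (auto simp: S_def)
    then show ?thesis using v(2) mon_append_nonzeroD[of "u @ take i v" "drop i v"] by simp
  qed
  have finT: "finite T"
    unfolding T_def S_def
    by (rule finite_UnI[OF finite_subset[OF _ finite_words[of n]]]) auto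
  have "inj_on (\<lambda>i. u @ take i v) {..k}"
  proof (rule inj_onI)
    fix i j assume "i \<in> {..k}" "j \<in> {..k}" "u @ take i v = u @ take j v"
    then have "length (take i v) = length (take j v)" "i \<le> D" "j \<le> D" by (simp_all add: D_def)
    then show "i = j" using v(1) by simp
  qed
  then have "card (S k) = k + 1" unfolding S_def by (simp add: card_image)
  then have cardT: "k + 1 \<le> card T"
    using card_mono[OF finT, of "S k"] by (simp add: T_def)
  let ?Z = "{w :: 'x list. length w \<le> n + m} \<union> S D"
  have finZ: "finite ?Z" using finite_words[of "n + m"] by (simp add: S_def)
  have "regular.product_space (span (mon ` T)) (filtration m) \<subseteq> span (mon ` ?Z)"
    unfolding filtration_def
  proof (rule product_space_span_subset)
    fix s t assume "s \<in> mon ` T" "t \<in> mon ` {w. length w \<le> m}"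
    then obtain w z where wz: "w \<in> T" "length z \<le> m" and st: "s * t = mon (w @ z)"
      by (auto simp: mon_append)
    show "s * t \<in> span (mon ` ?Z)"
    proof (cases "mon (w @ z) = 0")
      case True
      then show ?thesis using st by (simp add: span_zero)
    next
      case False
      have "w @ z \<in> ?Z"
      proof (cases "length w \<le> n")
        case True
        then show ?thesis using wz(2) by simp
      next
        case long: False
        then obtain i where i: "i \<le> k" "w = u @ take i v" using wz(1) by (auto simp: T_def S_def)
        have len: "length (take i v @ z) \<le> D" using i(1) wz(2) by (simp add: D_def)
        have "mon (u @ take i v @ z) \<noteq> 0" using False i(2) by simp
        then have "take i v @ z = take (length (take i v @ z)) v" by (rule uniq[OF len])
        then have "w @ z = u @ take (length (take i v @ z)) v" using i(2) by (metis append.assoc)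
        then have "w @ z \<in> S D" using len unfolding S_def by blast
        then show ?thesis by simp
      qed
      then show ?thesis unfolding st by (intro span_base imageI)
    qed
  qed
  then have "dim (regular.product_space (span (mon ` T)) (filtration m)) \<le> card (mon ` ?Z)"
    by (rule dim_le_card) (use finZ in simp)
  also have "\<dots> \<le> card ?Z" by (rule card_image_le[OF finZ])
  also have "\<dots> \<le> C + card (S D)" unfolding C_def by (rule card_Un_le)
  also have "card (S D) \<le> D + 1" unfolding S_def using card_image_le[of "{..D}"] by fastforce
  finally have "real (dim (regular.product_space (span (mon ` T)) (filtration m)))
      \<le> real (C + m + 1) + real k" by (simp add: D_def)
  also have "\<dots> < \<epsilon> * real k + real k"
    using k \<open>\<epsilon> > 0\<close> by (simp add: field_simps)
  also have "\<dots> \<le> (1 + \<epsilon>) * real (card T)"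
    using mult_left_mono[of "real k" "real (card T)" "1 + \<epsilon>"] cardT \<open>\<epsilon> > 0\<close>
    by (simp add: algebra_simps)
  finally show ?thesis
    using finT nzS by (intro exI[of _ T]) (auto simp: T_def)
qed

text \<open>
  By the Leibniz-like rule \<open>coeff [x] (a * b) = coeff [] a * coeff [x] b + coeff [x] a * coeff [] b\<close>, the
  elements with coefficient \<open>0\<close> at a non-zero letter \<open>x\<close> form a proper subalgebra.
\<close>
lemma generating_subspace_letter:
  assumes gen: "generating_subspace V" and x: "mon [x] \<noteq> 0"
  shows "\<exists>v\<in>V. coeff [x] v \<noteq> 0"
proof (rule ccontr)
  assume none: "\<not> ?thesis"
  let ?B = "{a. coeff [x] a = 0}"
  have "coeff [x] 1 = 0"
    using coeff_mon[OF x, of "[]"] by (simp add: mon_Nil)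
  moreover have "coeff [x] (a * b) = 0" if "coeff [x] a = 0" "coeff [x] b = 0" for a b
    using that by (simp add: coeff_mult[OF x])
  ultimately have "unital_subalgebra ?B"
    by (auto simp: unital_subalgebra_def subspace_def coeff.add coeff.scale)
  then have "unital_subalgebra hull V \<subseteq> ?B"
    using none by (intro hull_minimal) auto
  then have "mon [x] \<in> ?B" using gen by (auto simp: generating_subspace_def)
  then show False using coeff_mon[OF x, of "[x]"] by simp
qed

text \<open>
  Each word \<open>u\<close> of \<open>T\<close> is multiplied by an element \<open>v\<close> of \<open>V\<close> such that one of the shortest words
  in the product determines \<open>u\<close>.  If some \<open>v\<close> in \<open>V\<close> has a non-zero constant coefficient, it serves for all \<open>u\<close>, and
  \<open>u\<close> itself is that word.  Otherwise all products lie in higher length, and for a non-zero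
  prolongation \<open>u @ [x]\<close> an element with non-zero coefficient at \<open>[x]\<close> is chosen; a word \<open>u @ [x]\<close> has only
  one prefix of the length of \<open>u\<close>.
\<close>
lemma card_le_dim_product_generating:
  assumes rp: "right_prolongable" and V: "finite_dim_subspace V" and gen: "generating_subspace V"
    and T: "finite T" "\<And>w. w \<in> T \<Longrightarrow> mon w \<noteq> 0"
  shows "card T \<le> dim (regular.product_space (span (mon ` T)) V)"
proof -
  let ?P = "regular.product_space (span (mon ` T)) V"
  have "finite_dim_subspace ?P"
    using T(1) V by (intro finite_dim_product_space finite_dim_span finite_imageI)
  then obtain B where B: "finite B" "span B = ?P"
    by (auto simp: finite_dim_subspace_def)
  have yP: "(\<lambda>u. mon u * v u) ` T \<subseteq> span B" if "\<And>u. u \<in> T \<Longrightarrow> v u \<in> V" for v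
    unfolding B(2) using that by (auto intro!: product_in_product_space span_base)
  have "card T \<le> dim (span B)"
  proof (cases "\<exists>v\<in>V. coeff [] v \<noteq> 0")
    case True
    then obtain v where v: "v \<in> V" "coeff [] v \<noteq> 0" by blast
    show ?thesis
    proof (rule triangular_functionals_card_le_dim[where y = "\<lambda>u. mon u * v" and f = coeff and h = length])
      show "coeff i (mon i * v) \<noteq> 0" if "i \<in> T" for i
        using v(2) T(2)[OF that] by (simp add: coeff_mon_mult)
      show "coeff i (mon j * v) = 0" if "i \<in> T" "i \<noteq> j" "length i \<le> length j" for i j
        using that T(2)[OF that(1)] by (simp add: coeff_mon_mult)
    qed (use T(1) yP[of "\<lambda>_. v"] v(1) B(1) linear_coeff in simp_all)
  next
    case False
    then have aug: "coeff [] v = 0" if "v \<in> V" for v using that by blast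
    have "\<exists>x v. mon (u @ [x]) \<noteq> 0 \<and> v \<in> V \<and> coeff [x] v \<noteq> 0" if u: "u \<in> T" for u
    proof -
      obtain z where z: "length z = 1" "mon (u @ z) \<noteq> 0"
        using prolong_word[OF rp T(2)[OF u]] by blast
      then obtain x where "z = [x]" by (auto simp: length_Suc_conv)
      then show ?thesis
        using z(2) generating_subspace_letter[OF gen, of x] mon_append_nonzeroD[of u "[x]"] by blast
    qed
    then obtain x v where xv: "\<And>u. u \<in> T \<Longrightarrow> mon (u @ [x u]) \<noteq> 0"
        "\<And>u. u \<in> T \<Longrightarrow> v u \<in> V" "\<And>u. u \<in> T \<Longrightarrow> coeff [x u] (v u) \<noteq> 0"
      by metis
    show ?thesis
    proof (rule triangular_functionals_card_le_dim[where y = "\<lambda>u. mon u * v u"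
          and f = "\<lambda>u. coeff (u @ [x u])" and h = length])
      show "coeff (i @ [x i]) (mon i * v i) \<noteq> 0" if "i \<in> T" for i
        using xv(1,3)[OF that] by (simp add: coeff_mon_mult)
      show "coeff (i @ [x i]) (mon j * v j) = 0"
        if ij: "i \<in> T" "j \<in> T" "i \<noteq> j" "length i \<le> length j" for i j
      proof (cases "length i = length j")
        case True
        then show ?thesis using xv(1)[OF ij(1)] ij(3) by (simp add: coeff_mon_mult)
      next
        case False
        then have "drop (length j) (i @ [x i]) = []" using ij(4) by simp
        then show ?thesis
          using xv(1)[OF ij(1)] aug[OF xv(2)[OF ij(2)]] by (simp add: coeff_mon_mult del: drop_append)
      qed
    qed (use T(1) yP[of v] xv(2) B(1) linear_coeff in simp_all)
  qed
  then show ?thesis by (simp add: B(2))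
qed

section \<open>Folner sequences and exhaustive amenability\<close>

lemma regular_finite_dim_subspace: "regular.finite_dim_subspace = finite_dim_subspace"
  by (simp add: fun_eq_iff regular.finite_dim_subspace_def finite_dim_subspace_def)

lemma filtration_subset_span_mon:
  assumes "{w. length w \<le> n \<and> mon w \<noteq> 0} \<subseteq> T"
  shows "filtration n \<subseteq> span (mon ` T)"
  unfolding filtration_def
proof (intro span_minimal subspace_span, rule image_subsetI)
  fix w :: "'x list" assume "w \<in> {w. length w \<le> n}"
  then show "mon w \<in> span (mon ` T)"
    using assms by (cases "mon w = 0") (auto intro: span_zero span_base)
qed

text \<open>
  The terms are chosen one after another, the next one containing all non-zero words up to the greatest
  length that occurs in the previous one.  Containing all words of length at most \<open>n\<close> makes the sequence
  exhaust \<open>A\<close>, and the growth ratio lies between \<open>1\<close> and \<open>1 + 1 / Suc n\<close>.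
\<close>
lemma rigid_word_imp_folner_sequence:
  assumes rp: "right_prolongable" and rigid: "\<And>D. \<exists>u. rigid_word D u"
    and V: "finite_dim_subspace V" and gen: "generating_subspace V"
  shows "\<exists>L. regular.folner_sequence V L \<and> (\<forall>n. monomial_subspace (L n))"
proof -
  obtain m where m: "V \<subseteq> filtration m" using finite_dim_subset_filtration[OF V] by blast
  define P where "P n T \<longleftrightarrow> finite T \<and> (\<forall>w\<in>T. mon w \<noteq> 0) \<and>
      {w. length w \<le> n \<and> mon w \<noteq> 0} \<subseteq> T \<and>
      real (dim (regular.product_space (span (mon ` T)) V)) < (1 + 1 / real (Suc n)) * real (card T)"
    for n T
  have ex: "\<exists>T. P n T \<and> {w. length w \<le> N \<and> mon w \<noteq> 0} \<subseteq> T" for n N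
  proof -
    obtain T where T: "finite T" "\<forall>w\<in>T. mon w \<noteq> 0"
        "{w. length w \<le> max n N \<and> mon w \<noteq> 0} \<subseteq> T"
        "real (dim (regular.product_space (span (mon ` T)) (filtration m)))
          < (1 + 1 / real (Suc n)) * real (card T)"
      using invariant_span_of_words[OF rp rigid, of "1 / real (Suc n)" "max n N" m] by auto
    have "dim (regular.product_space (span (mon ` T)) V)
        \<le> dim (regular.product_space (span (mon ` T)) (filtration m))"
      by (intro dim_mono_finite_dim product_space_mono order_refl m finite_dim_product_space
          finite_dim_span finite_imageI T(1) finite_dim_filtration)
    then have "real (dim (regular.product_space (span (mon ` T)) V))
        < (1 + 1 / real (Suc n)) * real (card T)"
      using T(4) by (meson of_nat_le_iff order_le_less_trans)
    moreover have "{w. length w \<le> n \<and> mon w \<noteq> 0} \<subseteq> T" "{w. length w \<le> N \<and> mon w \<noteq> 0} \<subseteq> T"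
      using T(3) by auto
    ultimately show ?thesis
      using T(1,2) unfolding P_def by blast
  qed
  have "\<exists>T. \<forall>n. P n (T n) \<and> T n \<subseteq> T (Suc n)"
  proof (rule dependent_nat_choice)
    show "\<exists>T. P 0 T" using ex by blast
  next
    fix T n assume T: "P n T"
    then obtain N where N: "\<forall>w\<in>T. length w \<le> N"
      using finite_nat_set_iff_bounded_le[of "length ` T"] by (auto simp: P_def)
    obtain T' where "P (Suc n) T'" "{w. length w \<le> N \<and> mon w \<noteq> 0} \<subseteq> T'" using ex by blast
    moreover have "T \<subseteq> {w. length w \<le> N \<and> mon w \<noteq> 0}" using T N by (auto simp: P_def)
    ultimately show "\<exists>T'. P (Suc n) T' \<and> T \<subseteq> T'" by blast
  qed
  then obtain T where PT: "\<And>n. P n (T n)" and chain: "\<And>n. T n \<subseteq> T (Suc n)" by blast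
  have fin: "finite (T n)" and nz: "\<And>w. w \<in> T n \<Longrightarrow> mon w \<noteq> 0"
    and ball: "{w. length w \<le> n \<and> mon w \<noteq> 0} \<subseteq> T n"
    and inv: "real (dim (regular.product_space (span (mon ` T n)) V))
      < (1 + 1 / real (Suc n)) * real (card (T n))" for n
    using PT[of n] unfolding P_def by blast+
  define L where "L n = span (mon ` T n)" for n
  have dimL: "dim (L n) = card (T n)" for n
    unfolding L_def by (rule dim_span_mon[OF fin nz])
  have Nil: "[] \<in> T n" for n using ball[of n] by (auto simp: mon_Nil)
  then have pos: "0 < card (T n)" for n using fin[of n] card_gt_0_iff by blast
  have "regular.folner_sequence V L"
    unfolding regular.folner_sequence_def regular_finite_dim_subspace
  proof (intro conjI allI)
    fix n
    show "finite_dim_subspace (L n)" unfolding L_def by (intro finite_dim_span finite_imageI fin)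
    have "mon [] \<in> L n" unfolding L_def by (intro span_base imageI Nil)
    then show "L n \<noteq> {0}" by (auto simp: mon_Nil)
    show "L n \<subseteq> L (Suc n)" unfolding L_def by (intro span_mono image_mono chain)
  next
    have "a \<in> (\<Union>n. L n)" for a
    proof -
      obtain n where "a \<in> filtration n" using in_filtration by blast
      then show ?thesis using filtration_subset_span_mon[OF ball] unfolding L_def by blast
    qed
    then show "(\<Union>n. L n) = UNIV" by blast
  next
    let ?r = "\<lambda>n. real (dim (regular.product_space (L n) V)) / real (dim (L n))"
    show "?r \<longlonglongrightarrow> 1"
    proof (rule tendsto_sandwich)
      show "\<forall>\<^sub>F n in sequentially. 1 \<le> ?r n"
        using card_le_dim_product_generating[OF rp V gen fin nz] pos
        by (intro always_eventually allI) (simp add: dimL L_def[symmetric] le_divide_eq)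
      show "\<forall>\<^sub>F n in sequentially. ?r n \<le> 1 + 1 / real (Suc n)"
        using inv pos
        by (intro always_eventually allI) (simp add: dimL L_def[symmetric] divide_le_eq less_imp_le)
      show "(\<lambda>n. 1 + 1 / real (Suc n)) \<longlonglongrightarrow> 1"
        using LIMSEQ_inverse_real_of_nat_add[of 1] by (simp only: inverse_eq_divide)
    qed simp
  qed
  moreover have "monomial_subspace (L n)" for n
    unfolding monomial_subspace_def L_def monomials_def
    by (intro exI[of _ "mon ` T n"]) auto
  ultimately show ?thesis by blast
qed

lemma generating_subspace_filtration:
  assumes "0 < n"
  shows "generating_subspace (filtration n)"
proof -
  have "B = UNIV" if B: "unital_subalgebra B" "filtration n \<subseteq> B" for B
  proof -
    have sub: "subspace B" and one: "1 \<in> B" and mult: "\<And>a b. a \<in> B \<Longrightarrow> b \<in> B \<Longrightarrow> a * b \<in> B"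
      using B(1) by (auto simp: unital_subalgebra_def)
    have "mon w \<in> B" for w
    proof (induction w)
      case Nil
      show ?case using one by (simp add: mon_Nil)
    next
      case (Cons x w)
      have "mon [x] \<in> filtration n"
        unfolding filtration_def using assms by (intro span_base imageI) simp
      then have "mon [x] * mon w \<in> B" using B(2) Cons mult by blast
      then show ?case by (simp flip: mon_append)
    qed
    then have "filtration k \<subseteq> B" for k
      unfolding filtration_def by (intro span_minimal sub) blast
    then show ?thesis using in_filtration by blast
  qed
  then have "unital_subalgebra hull (filtration n) = UNIV"
    unfolding hull_def by blast
  then show ?thesis
    by (simp add: generating_subspace_def filtration_def)
qed

text \<open>
  Enlarging \<open>U\<close> to a filtration step makes it generating and only enlarges the products.  A late term
  of the corresponding sequence contains \<open>W\<close>, because \<open>W\<close> is finitely spanned, and has a small growth ratio.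
\<close>
lemma folner_sequence_imp_exhaustively_amenable:
  assumes folner: "\<And>V. finite_dim_subspace V \<Longrightarrow> generating_subspace V \<Longrightarrow>
    \<exists>L. regular.folner_sequence V L"
  shows "regular.exhaustively_amenable"
  unfolding regular.exhaustively_amenable_def regular_finite_dim_subspace
proof (intro allI impI)
  fix U W :: "'a set" and \<epsilon> :: real
  assume U: "finite_dim_subspace U" and \<epsilon>: "0 < \<epsilon>" and W: "finite_dim_subspace W"
  obtain m where "U \<subseteq> filtration m" using finite_dim_subset_filtration[OF U] by blast
  then have UV: "U \<subseteq> filtration (Suc m)" using filtration_mono[of m "Suc m"] by auto
  obtain L where L: "regular.folner_sequence (filtration (Suc m)) L"
    using folner finite_dim_filtration generating_subspace_filtration by blast
  have fd: "finite_dim_subspace (L n)" and nonzero: "L n \<noteq> {0}" and chain: "L n \<subseteq> L (Suc n)"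
    and union: "(\<Union>n. L n) = UNIV" for n
    using L unfolding regular.folner_sequence_def regular_finite_dim_subspace by blast+
  have mono: "L i \<subseteq> L j" if "i \<le> j" for i j using lift_Suc_mono_le[of L, OF chain that] .
  let ?r = "\<lambda>n. real (dim (regular.product_space (L n) (filtration (Suc m)))) / real (dim (L n))"
  have "?r \<longlonglongrightarrow> 1"
    using L unfolding regular.folner_sequence_def by blast
  then have "\<forall>\<^sub>F n in sequentially. ?r n < 1 + \<epsilon>"
    using \<epsilon> by (intro order_tendstoD(2)) auto
  then obtain n0 where n0: "\<And>n. n0 \<le> n \<Longrightarrow> ?r n < 1 + \<epsilon>"
    unfolding eventually_sequentially by blast
  obtain B where B: "finite B" "span B = W" using W by (auto simp: finite_dim_subspace_def)
  have "\<exists>k. b \<in> L k" for b using union by blast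
  then obtain k where k: "\<And>b. b \<in> L (k b)" by metis
  obtain n1 where n1: "\<forall>b\<in>B. k b \<le> n1"
    using B(1) finite_nat_set_iff_bounded_le[of "k ` B"] by auto
  define n where "n = max n0 n1"
  have "b \<in> L n" if "b \<in> B" for b
  proof -
    have "k b \<le> n" using n1 that by (simp add: n_def le_max_iff_disj)
    then show ?thesis using k[of b] mono by blast
  qed
  then have "W \<subseteq> L n"
    unfolding B(2)[symmetric] using fd[of n] by (intro span_minimal) (auto simp: finite_dim_subspace_def)
  (* With dim (L n) = 0 the quotient would be 0 by convention and say nothing about invariance. *)
  have "dim (L n) \<noteq> 0"
  proof
    assume zero: "dim (L n) = 0"
    obtain C where C: "finite C" "span C = L n" using fd[of n] by (auto simp: finite_dim_subspace_def)
    obtain B' where B': "B' \<subseteq> L n" "independent B'" "L n \<subseteq> span B'" "card B' = dim (L n)"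
      by (rule basis_exists)
    have "B' = {}" using independent_span_bound[OF C(1) B'(2)] B'(1,4) C(2) zero by simp
    then have "L n \<subseteq> {0}" using B'(3) by simp
    moreover have "0 \<in> L n" using C(2) span_zero by blast
    ultimately show False using nonzero[of n] by blast
  qed
  then have "real (dim (regular.product_space (L n) (filtration (Suc m)))) < (1 + \<epsilon>) * real (dim (L n))"
    using n0[of n] by (simp add: n_def divide_less_eq)
  moreover have "dim (regular.product_space (L n) U)
      \<le> dim (regular.product_space (L n) (filtration (Suc m)))"
    by (intro dim_mono_finite_dim product_space_mono order_refl UV finite_dim_product_space fd
        finite_dim_filtration)
  ultimately have "regular.invariant_subspace U \<epsilon> (L n)"
    unfolding regular.invariant_subspace_def regular_finite_dim_subspace using fd[of n] by linarith
  with \<open>W \<subseteq> L n\<close> show "\<exists>L. regular.invariant_subspace U \<epsilon> L \<and> W \<subseteq> L" by blast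
qed

lemma exhaustively_amenable_imp_amenable:
  assumes "regular.exhaustively_amenable"
  shows "regular.amenable"
  unfolding regular.amenable_def
proof (intro allI impI)
  fix V :: "'a set" and \<epsilon> :: real assume "finite_dim_subspace V" "0 < \<epsilon>"
  moreover have "regular.finite_dim_subspace {0}"
    using finite_dim_span[of "{}"] by (simp add: regular_finite_dim_subspace)
  ultimately show "\<exists>L. regular.invariant_subspace V \<epsilon> L"
    using assms unfolding regular.exhaustively_amenable_def by blast
qed

end

theorem theorem3p1:
  fixes scale :: "'k::field \<Rightarrow> 'a::ring_1 \<Rightarrow> 'a"
    and \<phi> :: "('x::finite, 'k) free_algebra \<Rightarrow> 'a"
    and R :: "'x list set"
  assumes "monomial_algebra scale \<phi> R"
    and "monomial_algebra.right_prolongable \<phi>"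
  shows "(right_module.amenable scale scale (*) \<longleftrightarrow>
           (\<forall>D. \<exists>u\<in>monomial_algebra.monomials \<phi>. u \<noteq> 0 \<and>
             (\<exists>\<^sub>\<le>\<^sub>1 v. v \<in> monomial_algebra.monomials_of_length \<phi> D \<and> u * v \<noteq> 0))) \<and>
         ((\<forall>D. \<exists>u\<in>monomial_algebra.monomials \<phi>. u \<noteq> 0 \<and>
             (\<exists>\<^sub>\<le>\<^sub>1 v. v \<in> monomial_algebra.monomials_of_length \<phi> D \<and> u * v \<noteq> 0)) \<longleftrightarrow>
           (\<forall>V. k_algebra.finite_dim_subspace scale V \<longrightarrow> k_algebra.generating_subspace scale V \<longrightarrow>
             (\<exists>L. right_module.folner_sequence scale (*) V L \<and>
               (\<forall>n. monomial_algebra.monomial_subspace scale \<phi> (L n))))) \<and>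
         ((\<forall>V. k_algebra.finite_dim_subspace scale V \<longrightarrow> k_algebra.generating_subspace scale V \<longrightarrow>
             (\<exists>L. right_module.folner_sequence scale (*) V L \<and>
               (\<forall>n. monomial_algebra.monomial_subspace scale \<phi> (L n)))) \<longleftrightarrow>
           right_module.exhaustively_amenable scale scale (*))"
    (is "(?amenable \<longleftrightarrow> ?rigid) \<and> (?rigid \<longleftrightarrow> ?folner) \<and> (?folner \<longleftrightarrow> ?exhaustive)")
proof -
  interpret monomial_algebra scale \<phi> R by (rule assms(1))
  have rigid: "?rigid \<longleftrightarrow> (\<forall>D. \<exists>u. rigid_word D u)"
    by (simp only: rigid_monomial_iff_rigid_word)
  have "?amenable \<Longrightarrow> ?rigid"
    unfolding rigid using amenable_imp_rigid_word by blast
  moreover have "?rigid \<Longrightarrow> ?folner"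
    unfolding rigid using rigid_word_imp_folner_sequence[OF assms(2)] by blast
  moreover have "?folner \<Longrightarrow> ?exhaustive"
    by (rule folner_sequence_imp_exhaustively_amenable) blast
  moreover have "?exhaustive \<Longrightarrow> ?amenable"
    by (rule exhaustively_amenable_imp_amenable)
  ultimately show ?thesis by blast
qed

end
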